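(* There exists an absolute constant $C>0$ such that the following holds. Let $Q\ge 4$ and let $m\ge 2$ be an integer. Suppose that $\mathcal{B}\subset\mathbb{Q}_{\le Q}$ is such that there is $n\ge 1$ with $|\mathcal{B}\cap\mathbb{Q}_{=q}|\le n$ for every integer $1\le q\le Q$. Then $$E_{2m}(\mathcal{B})\le (\log Q)^{C^m}(Qn)^m.$$
   Context: For a positive integer $q$, $\mathbb{Q}_{=q}:=\{a/q\in[0,1]: 1\le a\le q,\ \gcd(a,q)=1\}$ is the set of reduced rationals with denominator exactly $q$, and $\mathbb{Q}_{\le Q}:=\bigcup_{1\le q\le Q}\mathbb{Q}_{=q}$. For a finite set $\mathcal{B}$ of real numbers, the $2m$-fold additive energy is $$E_{2m}(\mathcal{B}):=|\{(b_1,\ldots,b_{2m})\in\mathcal{B}^{2m}: b_1+\cdots+b_m=b_{m+1}+\cdots+b_{2m}\}|,$$ where the equation is between real (rational) numbers. *)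

theory Defs
  imports Complex_Main "HOL-Library.FuncSet"
begin

definition rationals_eq :: "nat \<Rightarrow> real set" where
  "rationals_eq q =
     {real a / real q | a. real a / real q \<in> {0..1} \<and> 1 \<le> a \<and> a \<le> q \<and> coprime a q}"

definition rationals_le :: "real \<Rightarrow> real set" where
  "rationals_le Q = (\<Union>q\<in>{q::nat. 1 \<le> q \<and> real q \<le> Q}. rationals_eq q)"

(* additive_energy m B is the 2m-fold energy E_{2m}(B); the argument is m, not 2m.
   A tuple in B^{2m} is an extensional function on {1..2*m}. Only meaningful for finite B. *)
definition additive_energy :: "nat \<Rightarrow> real set \<Rightarrow> nat" where
  "additive_energy m B =
     card {b \<in> {1..2*m} \<rightarrow>\<^sub>E B. (\<Sum>i = 1..m. b i) = (\<Sum>i = m+1..2*m. b i)}"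

end

theory Submission
  imports Defs "HOL-Analysis.Harmonic_Numbers" "HOL-Library.Real_Mod"
    "HOL-Computational_Algebra.Primes"
begin

text \<open>The map \<open>b \<mapsto> exp (\<plusminus>2\<pi>ib)\<close> turns the solutions with prescribed denominators
  \<open>q\<^sub>1, \<dots>, q\<^sub>2\<^sub>m\<close> into tuples of roots of unity with product 1, the \<open>i\<close>-th entry having exact order
  \<open>q\<^sub>i\<close>. If such a tuple exists, then no prime power divides exactly one of the \<open>q\<^sub>i\<close>. Hence, if
  \<open>d\<^sub>S\<close> denotes the product of all primes \<open>p\<close>, one for each \<open>k > 0\<close> with
  \<open>{i. p\<^sup>k dvd q\<^sub>i} = S\<close>, then \<open>q\<^sub>i\<close> is the product of the \<open>d\<^sub>S\<close> with \<open>i \<in> S\<close> and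
  only sets \<open>S\<close> with at least two elements occur. A Hoelder-type inequality, proved one prime factor
  at a time, bounds the number of solutions by \<open>n\<^sup>m\<close> times the product of the
  \<open>d\<^sub>S\<close> to the power \<open>card S / 2 - 1\<close>. Since the product of the \<open>d\<^sub>S\<close> to the power
  \<open>card S / 2\<close> is the square root of the product of the \<open>q\<^sub>i\<close>, thus at most \<open>Q\<^sup>m\<close>,
  summing over all \<open>d\<^sub>S \<le> Q\<close> costs only one harmonic sum for each \<open>S\<close>.\<close>

section \<open>Tuples with product 1 and a Hoelder-type inequality for them\<close>

definition prod_one_tuples :: "'i set \<Rightarrow> ('i \<Rightarrow> 'a::comm_monoid_mult set) \<Rightarrow> ('i \<Rightarrow> 'a) set" where
  "prod_one_tuples I F = {x \<in> Pi\<^sub>E I F. (\<Prod>i\<in>I. x i) = 1}"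

lemma finite_prod_one_tuples:
  assumes "finite I" and "\<And>i. i \<in> I \<Longrightarrow> finite (F i)"
  shows "finite (prod_one_tuples I F)"
  unfolding prod_one_tuples_def by (rule finite_subset[OF _ finite_PiE[of I F]]) (use assms in auto)

text \<open>A tuple with product 1 is determined by its entries away from \<open>j\<close>.\<close>

lemma sum_prod_one_tuples_le:
  fixes \<phi> :: "'i \<Rightarrow> 'a::field \<Rightarrow> real"
  assumes I: "finite I" and F: "\<And>i. i \<in> I \<Longrightarrow> finite (F i)"
    and nz: "\<And>i. i \<in> I \<Longrightarrow> 0 \<notin> F i" and j: "j \<in> I"
    and nonneg: "\<And>i z. \<phi> i z \<ge> 0"
  shows "(\<Sum>x\<in>prod_one_tuples I F. \<Prod>i\<in>I-{j}. \<phi> i (x i)) \<le> (\<Prod>i\<in>I-{j}. \<Sum>z\<in>F i. \<phi> i z)"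
proof -
  let ?X = "prod_one_tuples I F" and ?r = "\<lambda>x. restrict x (I - {j})"
  have inj: "inj_on ?r ?X"
  proof (rule inj_onI)
    fix x y assume x: "x \<in> ?X" and y: "y \<in> ?X" and eq: "?r x = ?r y"
    have agree: "x i = y i" if "i \<in> I - {j}" for i
      using that fun_cong[OF eq, of i] by simp
    let ?c = "\<Prod>i\<in>I-{j}. x i"
    have "x j * ?c = 1" "y j * (\<Prod>i\<in>I-{j}. y i) = 1"
      using x y prod.remove[OF I j, of x] prod.remove[OF I j, of y]
      by (auto simp: prod_one_tuples_def)
    moreover have "(\<Prod>i\<in>I-{j}. y i) = ?c" using agree by (intro prod.cong) auto
    ultimately have "x j * ?c = y j * ?c" "?c \<noteq> 0" by auto
    then have "x j = y j" by simp
    then show "x = y"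
      using agree x y by (intro PiE_ext[of x I F y]) (auto simp: prod_one_tuples_def)
  qed
  have "(\<Sum>x\<in>?X. \<Prod>i\<in>I-{j}. \<phi> i (x i)) = (\<Sum>x\<in>?r ` ?X. \<Prod>i\<in>I-{j}. \<phi> i (x i))"
    by (subst sum.reindex[OF inj]) auto
  also have "\<dots> \<le> (\<Sum>x\<in>Pi\<^sub>E (I - {j}) F. \<Prod>i\<in>I-{j}. \<phi> i (x i))"
    using I F nonneg
    by (intro sum_mono2 finite_PiE prod_nonneg) (auto simp: prod_one_tuples_def PiE_iff split: if_splits)
  also have "\<dots> = (\<Prod>i\<in>I-{j}. \<Sum>z\<in>F i. \<phi> i z)"
    using I F by (intro prod_sum_PiE[symmetric]) auto
  finally show ?thesis .
qed

lemma sum_le_sqrt_card_mult_L2: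
  fixes f :: "'a \<Rightarrow> real"
  assumes "real (card A) \<le> c"
  shows "(\<Sum>z\<in>A. f z) \<le> sqrt c * sqrt (\<Sum>z\<in>A. (f z)\<^sup>2)"
proof -
  have "(\<Sum>z\<in>A. 1 * f z)\<^sup>2 \<le> (\<Sum>z\<in>A. 1\<^sup>2) * (\<Sum>z\<in>A. (f z)\<^sup>2)"
    by (rule Cauchy_Schwarz_ineq_sum)
  also have "\<dots> \<le> c * (\<Sum>z\<in>A. (f z)\<^sup>2)"
    using assms by (intro mult_right_mono sum_nonneg) auto
  finally show ?thesis by (simp add: real_le_rsqrt real_sqrt_mult[symmetric])
qed

text \<open>Cauchy-Schwarz over the tuples separates the factors of \<open>j\<close> and
  \<open>k\<close>, each keeping half of the common weight \<open>h\<close> of the other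
  coordinates. In each of the two resulting sums one of \<open>j\<close>, \<open>k\<close> no longer
  occurs, so it can be taken as the determined coordinate in \<open>sum_prod_one_tuples_le\<close>.
  Thus \<open>j\<close> and \<open>k\<close> contribute their L2 norms without loss; every other
  coordinate enters through its L1 norm and pays \<open>sqrt (c i)\<close> for the passage to
  L2.\<close>

lemma sum_prod_one_tuples_L2:
  fixes f :: "'i \<Rightarrow> 'a::field \<Rightarrow> real"
  assumes I: "finite I" and F: "\<And>i. i \<in> I \<Longrightarrow> finite (F i)"
    and nz: "\<And>i. i \<in> I \<Longrightarrow> 0 \<notin> F i" and j: "j \<in> I" "k \<in> I" "j \<noteq> k"
    and nonneg: "\<And>i z. f i z \<ge> 0"
    and c: "\<And>i. i \<in> I \<Longrightarrow> real (card (F i)) \<le> c i"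
  shows "(\<Sum>x\<in>prod_one_tuples I F. \<Prod>i\<in>I. f i (x i))
    \<le> (\<Prod>i\<in>I-{j,k}. sqrt (c i)) * (\<Prod>i\<in>I. sqrt (\<Sum>z\<in>F i. (f i z)\<^sup>2))"
proof -
  let ?X = "prod_one_tuples I F" and ?J = "I - {j,k}"
  define h where "h x = (\<Prod>i\<in>?J. f i (x i))" for x
  define N where "N i = (\<Sum>z\<in>F i. (f i z)\<^sup>2)" for i
  define K where "K = (\<Prod>i\<in>?J. \<Sum>z\<in>F i. f i z)"
  have h: "h x \<ge> 0" for x unfolding h_def by (intro prod_nonneg) (use nonneg in auto)
  have N: "N i \<ge> 0" for i unfolding N_def by (intro sum_nonneg) auto
  have K: "K \<ge> 0" unfolding K_def by (intro prod_nonneg ballI sum_nonneg) (use nonneg in auto)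
  \<comment> \<open>Here \<open>a\<close> is the coordinate whose factor is squared and
    \<open>b\<close> the determined one that is dropped; both assignments of \<open>j\<close> and
    \<open>k\<close> are used below.\<close>
  have half: "(\<Sum>x\<in>?X. h x * (f a (x a))\<^sup>2) \<le> K * N a"
    if ab: "a \<in> I" "b \<in> I" "a \<noteq> b" "{a,b} = {j,k}" for a b
  proof -
    let ?\<phi> = "\<lambda>i z. if i = a then (f i z)\<^sup>2 else f i z"
    have J: "I - {b} = insert a ?J" "a \<notin> ?J" using ab by auto
    have "(\<Sum>x\<in>?X. \<Prod>i\<in>I-{b}. ?\<phi> i (x i)) \<le> (\<Prod>i\<in>I-{b}. \<Sum>z\<in>F i. ?\<phi> i z)"
      by (rule sum_prod_one_tuples_le) (use I F nz ab nonneg in auto)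
    moreover have "(\<Prod>i\<in>I-{b}. ?\<phi> i (x i)) = h x * (f a (x a))\<^sup>2" for x
    proof -
      have "(\<Prod>i\<in>?J. ?\<phi> i (x i)) = h x" unfolding h_def using J(2) by (intro prod.cong refl) auto
      then show ?thesis unfolding J(1) using I J(2) by simp
    qed
    moreover have "(\<Prod>i\<in>I-{b}. \<Sum>z\<in>F i. ?\<phi> i z) = K * N a"
    proof -
      have "(\<Prod>i\<in>?J. \<Sum>z\<in>F i. ?\<phi> i z) = K" unfolding K_def using J(2) by (intro prod.cong refl sum.cong) auto
      then show ?thesis unfolding J(1) N_def using I J(2) by simp
    qed
    ultimately show ?thesis by simp
  qed
  have split: "(\<Prod>i\<in>I. \<phi> i) = (\<Prod>i\<in>?J. \<phi> i) * \<phi> j * \<phi> k" for \<phi> :: "'i \<Rightarrow> real"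
  proof -
    have "I = insert j (insert k ?J)" using j by auto
    then have "(\<Prod>i\<in>I. \<phi> i) = (\<Prod>i\<in>insert j (insert k ?J). \<phi> i)" by (rule arg_cong)
    then show ?thesis using I j by simp
  qed
  have "(\<Sum>x\<in>?X. \<Prod>i\<in>I. f i (x i))\<^sup>2
      = (\<Sum>x\<in>?X. (sqrt (h x) * f j (x j)) * (sqrt (h x) * f k (x k)))\<^sup>2"
  proof (intro arg_cong[where f="\<lambda>t. t\<^sup>2"] sum.cong refl)
    fix x
    have "(\<Prod>i\<in>I. f i (x i)) = (sqrt (h x) * sqrt (h x)) * f j (x j) * f k (x k)"
      using h[of x] by (simp add: split h_def)
    then show "(\<Prod>i\<in>I. f i (x i)) = (sqrt (h x) * f j (x j)) * (sqrt (h x) * f k (x k))"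
      by (simp only: mult_ac)
  qed
  also have "\<dots> \<le> (\<Sum>x\<in>?X. (sqrt (h x) * f j (x j))\<^sup>2) * (\<Sum>x\<in>?X. (sqrt (h x) * f k (x k))\<^sup>2)"
    by (rule Cauchy_Schwarz_ineq_sum)
  also have "\<dots> = (\<Sum>x\<in>?X. h x * (f j (x j))\<^sup>2) * (\<Sum>x\<in>?X. h x * (f k (x k))\<^sup>2)"
    using h by (simp add: power_mult_distrib)
  also have "\<dots> \<le> (K * N j) * (K * N k)"
  proof (rule mult_mono)
    show "(\<Sum>x\<in>?X. h x * (f j (x j))\<^sup>2) \<le> K * N j" using j by (intro half[of j k]) auto
    show "(\<Sum>x\<in>?X. h x * (f k (x k))\<^sup>2) \<le> K * N k" using j by (intro half[of k j]) auto
    show "0 \<le> K * N j" using K N by simp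
    show "0 \<le> (\<Sum>x\<in>?X. h x * (f k (x k))\<^sup>2)" using h by (intro sum_nonneg) simp
  qed
  also have "\<dots> = (K * sqrt (N j) * sqrt (N k))\<^sup>2"
  proof -
    have "(K * sqrt (N j) * sqrt (N k))\<^sup>2 = K\<^sup>2 * N j * N k"
      using N by (simp add: power_mult_distrib)
    then show ?thesis by (simp only: power2_eq_square mult_ac)
  qed
  finally have "(\<Sum>x\<in>?X. \<Prod>i\<in>I. f i (x i)) \<le> K * sqrt (N j) * sqrt (N k)"
    by (rule power2_le_imp_le) (use K N in auto)
  also have "\<dots> \<le> (\<Prod>i\<in>?J. sqrt (c i) * sqrt (N i)) * sqrt (N j) * sqrt (N k)"
  proof -
    have "K \<le> (\<Prod>i\<in>?J. sqrt (c i) * sqrt (N i))"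
      unfolding K_def N_def
      by (intro prod_mono conjI sum_nonneg sum_le_sqrt_card_mult_L2) (use nonneg c in auto)
    then show ?thesis using N by (intro mult_right_mono) auto
  qed
  also have "\<dots> = (\<Prod>i\<in>?J. sqrt (c i)) * (\<Prod>i\<in>I. sqrt (N i))"
    by (simp add: split prod.distrib)
  finally show ?thesis by (simp add: N_def)
qed

section \<open>Roots of unity with product 1\<close>

lemma power_eq_1_coprime:
  fixes w :: "'a::field"
  assumes "coprime a b" "w ^ a = 1" "w ^ b = 1"
  shows "w = 1"
proof (cases "a = 0")
  \<comment> \<open>Coprimality with 0 forces \<open>b = 1\<close>; Bezout below requires
    \<open>a\<close> to be nonzero.\<close>
  case True then show ?thesis using assms by simp
next
  case False
  obtain x y where "a * x = b * y + 1"
    using coprime_bezout_strong[OF assms(1)] bezout_nat[OF False, of b] assms(1)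
    by (metis coprime_imp_gcd_eq_1)
  then have "w ^ (a * x) = w ^ (b * y) * w" by simp
  then show ?thesis using assms by (simp add: power_mult)
qed

text \<open>The index sets of the factors \<open>d S\<close>. A singleton would correspond to a
  prime power dividing exactly one order, which the hypotheses below exclude. On these sets the
  subtraction in \<open>card S - 2\<close> is never truncated.\<close>

definition nontrivial_subsets :: "'i set \<Rightarrow> 'i set set" where
  "nontrivial_subsets I = {S \<in> Pow I. 2 \<le> card S}"

lemma finite_nontrivial_subsets: "finite I \<Longrightarrow> finite (nontrivial_subsets I)"
  by (simp add: nontrivial_subsets_def)

text \<open>Induction on \<open>\<Prod>i\<in>I. q i\<close>: for a prime \<open>p\<close> dividing some \<open>q i\<close>, fibre the tuples over their
  images under \<open>z \<mapsto> z ^ p\<close>, whose orders are divided by \<open>p\<close> exactly on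
  \<open>S = {i. p dvd q i}\<close>. Each fibre has at most \<open>p\<close> points in these coordinates and one in the
  others, and it costs a factor \<open>sqrt p ^ (card S - 2)\<close>.\<close>

lemma sum_roots_of_unity_le:
  fixes q :: "'i \<Rightarrow> nat" and f :: "'i \<Rightarrow> complex \<Rightarrow> real"
  assumes I: "finite I" and "\<And>i. i \<in> I \<Longrightarrow> q i > 0"
    and "\<And>p k. prime p \<Longrightarrow> k > 0 \<Longrightarrow> card {i \<in> I. p ^ k dvd q i} \<noteq> 1"
    and "\<And>i z. f i z \<ge> 0"
  shows "\<exists>d. (\<forall>S. d S > 0) \<and> (\<forall>i\<in>I. q i = (\<Prod>S\<in>{S \<in> nontrivial_subsets I. i \<in> S}. d S)) \<and>
    (\<Sum>x\<in>prod_one_tuples I (\<lambda>i. {z. z ^ q i = 1}). \<Prod>i\<in>I. f i (x i))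
      \<le> (\<Prod>S\<in>nontrivial_subsets I. sqrt (real (d S)) ^ (card S - 2)) *
        (\<Prod>i\<in>I. sqrt (\<Sum>z | z ^ q i = 1. (f i z)\<^sup>2))"
  using assms(2-)
proof (induction "\<Prod>i\<in>I. q i" arbitrary: q f rule: less_induct)
  case less
  let ?P = "nontrivial_subsets I"
  have finP: "finite ?P" using I by (rule finite_nontrivial_subsets)
  show ?case
  proof (cases "\<forall>i\<in>I. q i = 1")
    \<comment> \<open>Only the constant tuple 1 is left, and with all \<open>d S = 1\<close> both
      sides equal the product of the \<open>f i 1\<close>.\<close>
    case True
    have "Pi\<^sub>E I (\<lambda>i. {z. z ^ q i = 1}) = {\<lambda>i\<in>I. 1::complex}"
      using True by (auto simp: PiE_eq_singleton cong: PiE_cong)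
    then have "prod_one_tuples I (\<lambda>i. {z. z ^ q i = 1}) = {\<lambda>i\<in>I. 1::complex}"
      by (auto simp: prod_one_tuples_def)
    moreover have "(\<Prod>i\<in>I. sqrt (\<Sum>z | z ^ q i = 1. (f i z)\<^sup>2)) = (\<Prod>i\<in>I. f i 1)"
      using True less.prems(3) by (intro prod.cong) auto
    ultimately show ?thesis using True by (intro exI[of _ "\<lambda>_. 1"]) auto
  next
    case False
    then obtain i0 p where i0: "i0 \<in> I" "prime p" "p dvd q i0"
      using prime_factor_nat by blast
    define S where "S = {i \<in> I. p dvd q i}"
    have p: "p > 1" using i0 prime_gt_1_nat by blast
    have SI: "S \<subseteq> I" and finS: "finite S" using I by (auto simp: S_def)
    have "card S \<noteq> 1" using less.prems(2)[OF i0(2), of 1] by (simp add: S_def)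
    moreover have "card S \<noteq> 0" using i0 finS by (auto simp: S_def)
    ultimately have cS: "2 \<le> card S" by linarith
    then have SP: "S \<in> ?P" using SI by (simp add: nontrivial_subsets_def)
    \<comment> \<open>The two coordinates that are free of loss in
      \<open>sum_prod_one_tuples_L2\<close> are chosen inside \<open>S\<close>, where the fibres can
      be large; this is what lowers the exponent from \<open>card S\<close> to
      \<open>card S - 2\<close>.\<close>
    obtain j k where jk: "j \<in> S" "k \<in> S" "j \<noteq> k"
      using cS card_le_Suc0_iff_eq[OF finS] by (metis not_less_eq_eq numeral_2_eq_2)
    define q' where "q' i = (if p dvd q i then q i div p else q i)" for i
    have q_eq: "q i = (if i \<in> S then p * q' i else q' i)" if "i \<in> I" for i
      using that by (auto simp: S_def q'_def)
    have q'_pos: "q' i > 0" if "i \<in> I" for i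
      using less.prems(1)[OF that] q_eq[OF that] by (cases "q' i = 0") (auto split: if_splits)
    have q'_le: "q' i \<le> q i" for i by (simp add: q'_def)
    have "(\<Prod>i\<in>I. q' i) < (\<Prod>i\<in>I. q i)"
    proof -
      have "(\<Prod>i\<in>I-{i0}. q' i) \<le> (\<Prod>i\<in>I-{i0}. q i)" by (intro prod_mono) (use q'_le in auto)
      moreover have "q' i0 < q i0" using q_eq[of i0] i0 q'_pos[of i0] p by (auto simp: S_def)
      moreover have "0 < (\<Prod>i\<in>I-{i0}. q i)" using less.prems(1) by (intro prod_pos) auto
      ultimately have "q' i0 * (\<Prod>i\<in>I-{i0}. q' i) < q i0 * (\<Prod>i\<in>I-{i0}. q i)"
        by (meson le_less_trans mult_le_mono2 mult_less_mono1)
      then show ?thesis using i0 I by (simp add: prod.remove)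
    qed
    \<comment> \<open>The hypothesis on prime powers passes to \<open>q'\<close>: for
      \<open>r = p\<close> the exponent shifts by one (outside \<open>S\<close> neither power
      divides, since \<open>e > 0\<close>), and for other primes removing a factor \<open>p\<close>
      changes nothing.\<close>
    moreover have "card {i \<in> I. r ^ e dvd q' i} \<noteq> 1" if r: "prime r" "e > 0" for r e
    proof (cases "r = p")
      case True
      have "{i \<in> I. r ^ e dvd q' i} = {i \<in> I. r ^ Suc e dvd q i}"
      proof -
        have "r ^ e dvd q' i \<longleftrightarrow> r ^ Suc e dvd q i" if "i \<in> I" for i
        proof (cases "i \<in> S")
          case True
          then have "q i = p * q' i" using q_eq[OF that] by simp
          moreover have "p ^ e dvd q' i \<longleftrightarrow> p * p ^ e dvd p * q' i" using p by simp
          ultimately show ?thesis by (simp only: \<open>r = p\<close> power_Suc)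
        next
          case False
          then have npq: "\<not> p dvd q i" and qq: "q' i = q i"
            using that by (simp_all add: S_def q'_def)
          have "p dvd p ^ e" "p dvd p ^ Suc e" using r(2) by (simp_all add: dvd_power)
          then have "\<not> p ^ e dvd q i" "\<not> p ^ Suc e dvd q i"
            using npq dvd_trans[of p _ "q i"] by metis+
          then show ?thesis unfolding \<open>r = p\<close> qq by simp
        qed
        then show ?thesis by auto
      qed
      then show ?thesis using less.prems(2)[OF r(1), of "Suc e"] by simp
    next
      case False
      then have cop: "coprime (r ^ e) p" using r i0 by (simp add: primes_coprime)
      have "r ^ e dvd q' i \<longleftrightarrow> r ^ e dvd q i" if "i \<in> I" for i
        using q_eq[OF that] coprime_dvd_mult_right_iff[OF cop] by simp
      then have "{i \<in> I. r ^ e dvd q' i} = {i \<in> I. r ^ e dvd q i}" by auto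
      then show ?thesis using less.prems(2)[OF r] by simp
    qed
    \<comment> \<open>The L2 norm of \<open>f i\<close> on the fibre of the \<open>p\<close>-th
      power map over \<open>y\<close>. With this choice the L2 norm of \<open>g i\<close> over the
      \<open>q' i\<close>-th roots of unity is exactly that of \<open>f i\<close> over the
      \<open>q i\<close>-th ones, so the norms survive the induction unchanged.\<close>
    moreover define g where
      "g i y = sqrt (\<Sum>z\<in>{z. z ^ q i = 1 \<and> z ^ p = y}. (f i z)\<^sup>2)" for i and y :: complex
    have g_nonneg: "g i y \<ge> 0" for i y unfolding g_def by (simp add: sum_nonneg)
    ultimately obtain d' where d': "\<And>T. d' T > 0"
      "\<And>i. i \<in> I \<Longrightarrow> q' i = (\<Prod>T\<in>{T \<in> ?P. i \<in> T}. d' T)"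
      "(\<Sum>x\<in>prod_one_tuples I (\<lambda>i. {z. z ^ q' i = 1}). \<Prod>i\<in>I. g i (x i))
      \<le> (\<Prod>T\<in>?P. sqrt (real (d' T)) ^ (card T - 2)) *
        (\<Prod>i\<in>I. sqrt (\<Sum>z | z ^ q' i = 1. (g i z)\<^sup>2))"
      using less.hyps[of q' g] q'_pos by blast
    \<comment> \<open>The prime divided out of all \<open>q i\<close> with \<open>i \<in> S\<close>
      is recorded in the factor of \<open>S\<close>.\<close>
    define d where "d T = (if T = S then p else 1) * d' T" for T
    have "q i = (\<Prod>T\<in>{T \<in> ?P. i \<in> T}. d T)" if i: "i \<in> I" for i
    proof -
      have "(\<Prod>T\<in>{T \<in> ?P. i \<in> T}. d T)
        = (\<Prod>T\<in>{T \<in> ?P. i \<in> T}. if T = S then p else 1) * q' i"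
        unfolding d_def prod.distrib d'(2)[OF i] ..
      also have "\<dots> = q i" using finP SP q_eq[OF i] by (simp add: prod.delta)
      finally show ?thesis ..
    qed
    moreover have "d T > 0" for T using d'(1)[of T] p by (simp add: d_def)
    moreover have "(\<Sum>x\<in>prod_one_tuples I (\<lambda>i. {z. z ^ q i = 1}). \<Prod>i\<in>I. f i (x i))
      \<le> (\<Prod>T\<in>?P. sqrt (real (d T)) ^ (card T - 2)) *
        (\<Prod>i\<in>I. sqrt (\<Sum>z | z ^ q i = 1. (f i z)\<^sup>2))"
    proof -
      let ?X = "prod_one_tuples I (\<lambda>i. {z::complex. z ^ q i = 1})"
      let ?Y = "prod_one_tuples I (\<lambda>i. {z::complex. z ^ q' i = 1})"
      let ?F = "\<lambda>y i. {z::complex. z ^ q i = 1 \<and> z ^ p = y i}"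
      define \<pi> where "\<pi> x = (\<lambda>i\<in>I. x i ^ p :: complex)" for x
      have fin_roots: "finite {z::complex. z ^ q i = 1}" "finite {z::complex. z ^ q' i = 1}"
        if "i \<in> I" for i
        using less.prems(1)[OF that] q'_pos[OF that] by (auto intro!: finite_roots_unity)
      have root_power: "(z ^ p) ^ q' i = 1" if "i \<in> I" "z ^ q i = 1" for i and z :: complex
      proof (cases "i \<in> S")
        case True then show ?thesis using that q_eq[of i] by (simp add: power_mult)
      next
        case False
        have "(z ^ p) ^ q' i = (z ^ q' i) ^ p" by (simp add: power_mult[symmetric] mult.commute)
        then show ?thesis using that q_eq[of i] False by simp
      qed
      have finX: "finite ?X" "finite ?Y" by (intro finite_prod_one_tuples I fin_roots; assumption)+
      have "\<pi> ` ?X \<subseteq> ?Y"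
      proof
        fix y assume "y \<in> \<pi> ` ?X"
        then obtain x where x: "x \<in> ?X" "y = \<pi> x" by auto
        have "(\<Prod>i\<in>I. \<pi> x i) = (\<Prod>i\<in>I. x i) ^ p" by (simp add: \<pi>_def prod_power_distrib)
        then show "y \<in> ?Y" using x root_power by (auto simp: prod_one_tuples_def \<pi>_def PiE_iff)
      qed
      then have "(\<Sum>x\<in>?X. \<Prod>i\<in>I. f i (x i))
          = (\<Sum>y\<in>?Y. \<Sum>x\<in>{x \<in> ?X. \<pi> x = y}. \<Prod>i\<in>I. f i (x i))"
        using finX by (intro sum.group[symmetric])
      also have "\<dots> \<le> (\<Sum>y\<in>?Y. sqrt (real p) ^ (card S - 2) * (\<Prod>i\<in>I. g i (y i)))"
      proof (rule sum_mono)
        fix y assume y: "y \<in> ?Y"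
        have fib: "{x \<in> ?X. \<pi> x = y} = prod_one_tuples I (?F y)"
        proof -
          have "y \<in> extensional I" using y by (auto simp: prod_one_tuples_def PiE_iff)
          then have "\<pi> x = y \<longleftrightarrow> (\<forall>i\<in>I. x i ^ p = y i)" for x
            by (auto simp: \<pi>_def fun_eq_iff extensional_def)
          then show ?thesis by (auto simp: prod_one_tuples_def PiE_iff)
        qed
        define c where "c i = (if i \<in> S then real p else 1)" for i
        have y0: "y i \<noteq> 0" if "i \<in> I" for i
          using y that q'_pos[OF that] by (auto simp: prod_one_tuples_def PiE_iff power_0_left)
        have card_F: "real (card (?F y i)) \<le> c i" if i: "i \<in> I" for i
        proof (cases "i \<in> S")
          case True
          have "card (?F y i) \<le> card {z. z ^ p = y i}"
            using y0[OF i] p by (intro card_mono finite_nth_roots) auto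
          then show ?thesis using True card_nth_roots[OF y0[OF i], of p] p by (simp add: c_def)
        next
          case False
          \<comment> \<open>Since \<open>p\<close> does not divide \<open>q i\<close>, the
            \<open>p\<close>-th power map is injective on the \<open>q i\<close>-th roots of
            unity.\<close>
          then have cop: "coprime p (q i)"
            using i i0 by (auto simp: S_def intro: prime_imp_coprime)
          have "z = w" if zw: "z \<in> ?F y i" "w \<in> ?F y i" for z w
          proof -
            have "w \<noteq> 0" using zw less.prems(1)[OF i] by (auto simp: power_0_left)
            have "(z / w) ^ p = 1" "(z / w) ^ q i = 1"
              using zw y0[OF i] by (auto simp: power_divide)
            then have "z / w = 1" using power_eq_1_coprime[OF cop] by blast
            then show "z = w" using \<open>w \<noteq> 0\<close> by simp
          qed
          moreover have "finite (?F y i)" using fin_roots(1)[OF i] by (rule rev_finite_subset) auto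
          ultimately have "card (?F y i) \<le> Suc 0" using card_le_Suc0_iff_eq by blast
          then show ?thesis using False by (simp add: c_def)
        qed
        have "(\<Sum>x\<in>prod_one_tuples I (?F y). \<Prod>i\<in>I. f i (x i))
          \<le> (\<Prod>i\<in>I-{j,k}. sqrt (c i)) * (\<Prod>i\<in>I. sqrt (\<Sum>z\<in>?F y i. (f i z)\<^sup>2))"
        proof (rule sum_prod_one_tuples_L2)
          fix i assume i: "i \<in> I"
          show "finite (?F y i)" using fin_roots(1)[OF i] by (rule rev_finite_subset) auto
          show "0 \<notin> ?F y i" using less.prems(1)[OF i] by (simp add: power_0_left)
        qed (use I SI jk less.prems(3) card_F in auto)
        moreover have "(\<Prod>i\<in>I-{j,k}. sqrt (c i)) = sqrt (real p) ^ (card S - 2)"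
        proof -
          have "(\<Prod>i\<in>I-{j,k}. sqrt (c i)) = (\<Prod>i\<in>S-{j,k}. sqrt (real p))"
            using I SI by (intro prod.mono_neutral_cong_right) (auto simp: c_def)
          also have "card (S - {j,k}) = card S - 2" using jk by (subst card_Diff_subset) auto
          then have "(\<Prod>i\<in>S-{j,k}. sqrt (real p)) = sqrt (real p) ^ (card S - 2)" by simp
          finally show ?thesis .
        qed
        ultimately show "(\<Sum>x\<in>{x \<in> ?X. \<pi> x = y}. \<Prod>i\<in>I. f i (x i))
          \<le> sqrt (real p) ^ (card S - 2) * (\<Prod>i\<in>I. g i (y i))"
          by (simp add: fib g_def)
      qed
      also have "\<dots> \<le> sqrt (real p) ^ (card S - 2) *
        ((\<Prod>T\<in>?P. sqrt (real (d' T)) ^ (card T - 2)) *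
        (\<Prod>i\<in>I. sqrt (\<Sum>z | z ^ q' i = 1. (g i z)\<^sup>2)))"
        unfolding sum_distrib_left[symmetric] using d'(3) by (intro mult_left_mono) auto
      also have "(\<Prod>i\<in>I. sqrt (\<Sum>z | z ^ q' i = 1. (g i z)\<^sup>2))
        = (\<Prod>i\<in>I. sqrt (\<Sum>z | z ^ q i = 1. (f i z)\<^sup>2))"
      proof (rule prod.cong[OF refl])
        fix i assume i: "i \<in> I"
        have "(\<Sum>y | y ^ q' i = 1. (g i y)\<^sup>2)
          = (\<Sum>y | y ^ q' i = 1. \<Sum>z\<in>{z \<in> {z. z ^ q i = 1}. z ^ p = y}. (f i z)\<^sup>2)"
          by (simp add: g_def sum_nonneg)
        also have "\<dots> = (\<Sum>z | z ^ q i = 1. (f i z)\<^sup>2)"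
          using fin_roots[OF i] root_power[OF i] by (intro sum.group) auto
        finally show "sqrt (\<Sum>z | z ^ q' i = 1. (g i z)\<^sup>2) = sqrt (\<Sum>z | z ^ q i = 1. (f i z)\<^sup>2)"
          by simp
      qed
      also have "sqrt (real p) ^ (card S - 2) * ((\<Prod>T\<in>?P. sqrt (real (d' T)) ^ (card T - 2)) * A)
        = (\<Prod>T\<in>?P. sqrt (real (d T)) ^ (card T - 2)) * A" for A
      proof -
        have "(\<Prod>T\<in>?P. sqrt (real (d T)) ^ (card T - 2))
          = (\<Prod>T\<in>?P. (if T = S then sqrt (real p) ^ (card S - 2) else 1) *
              sqrt (real (d' T)) ^ (card T - 2))"
          by (intro prod.cong) (auto simp: d_def real_sqrt_mult power_mult_distrib)
        also have "\<dots> = sqrt (real p) ^ (card S - 2) * (\<Prod>T\<in>?P. sqrt (real (d' T)) ^ (card T - 2))"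
          using finP SP by (simp add: prod.distrib prod.delta)
        finally show ?thesis by simp
      qed
      finally show ?thesis .
    qed
    ultimately show ?thesis by blast
  qed
qed

text \<open>The weighted inequality is applied to the indicator functions of the \<open>X i\<close>,
  whose L2 norms are the square roots of the cardinalities.\<close>

lemma card_prod_one_roots_of_unity_le:
  fixes q :: "'i \<Rightarrow> nat" and X :: "'i \<Rightarrow> complex set"
  assumes I: "finite I" and q: "\<And>i. i \<in> I \<Longrightarrow> q i > 0"
    and "\<And>p k. prime p \<Longrightarrow> k > 0 \<Longrightarrow> card {i \<in> I. p ^ k dvd q i} \<noteq> 1"
    and X: "\<And>i. i \<in> I \<Longrightarrow> X i \<subseteq> {z. z ^ q i = 1}"
  shows "\<exists>d. (\<forall>S. d S > 0) \<and> (\<forall>i\<in>I. q i = (\<Prod>S\<in>{S \<in> nontrivial_subsets I. i \<in> S}. d S)) \<and>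
    real (card (prod_one_tuples I X))
      \<le> (\<Prod>S\<in>nontrivial_subsets I. sqrt (real (d S)) ^ (card S - 2)) *
        (\<Prod>i\<in>I. sqrt (real (card (X i))))"
proof -
  let ?f = "\<lambda>i z. of_bool (z \<in> X i) :: real"
  let ?R = "prod_one_tuples I (\<lambda>i. {z::complex. z ^ q i = 1})"
  have fin: "finite {z::complex. z ^ q i = 1}" if "i \<in> I" for i
    using q[OF that] by (auto intro!: finite_roots_unity)
  have "real (card (prod_one_tuples I X))
      = (\<Sum>x\<in>prod_one_tuples I X. \<Prod>i\<in>I. ?f i (x i))"
    by (simp add: prod_one_tuples_def PiE_iff)
  also have "\<dots> \<le> (\<Sum>x\<in>?R. \<Prod>i\<in>I. ?f i (x i))"
  proof (rule sum_mono2)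
    show "finite ?R" by (intro finite_prod_one_tuples I fin)
    show "prod_one_tuples I X \<subseteq> ?R"
      using X by (fastforce simp: prod_one_tuples_def PiE_iff)
  qed (simp add: prod_nonneg)
  finally have le: "real (card (prod_one_tuples I X)) \<le> (\<Sum>x\<in>?R. \<Prod>i\<in>I. ?f i (x i))" .
  have "(\<Sum>z | z ^ q i = 1. (?f i z)\<^sup>2) = real (card (X i))" if i: "i \<in> I" for i
  proof -
    have "(\<Sum>z | z ^ q i = 1. (?f i z)\<^sup>2) = (\<Sum>z\<in>X i. 1)"
      by (rule sum.mono_neutral_cong_right[OF fin[OF i] X[OF i]]) auto
    then show ?thesis by simp
  qed
  then have norm: "(\<Prod>i\<in>I. sqrt (\<Sum>z | z ^ q i = 1. (?f i z)\<^sup>2)) = (\<Prod>i\<in>I. sqrt (real (card (X i))))"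
    by (intro prod.cong) auto
  have "\<exists>d. (\<forall>S. d S > 0) \<and> (\<forall>i\<in>I. q i = (\<Prod>S\<in>{S \<in> nontrivial_subsets I. i \<in> S}. d S)) \<and>
    (\<Sum>x\<in>?R. \<Prod>i\<in>I. ?f i (x i))
      \<le> (\<Prod>S\<in>nontrivial_subsets I. sqrt (real (d S)) ^ (card S - 2)) *
        (\<Prod>i\<in>I. sqrt (\<Sum>z | z ^ q i = 1. (?f i z)\<^sup>2))"
    by (rule sum_roots_of_unity_le) (use assms in auto)
  then show ?thesis unfolding norm using le by (meson order_trans)
qed

section \<open>Prime powers dividing the orders\<close>

text \<open>The multiplicity of \<open>p\<close> in a least common multiple is the maximum of the
  multiplicities. For empty \<open>A\<close> the \<open>Lcm\<close> is 1, and \<open>k > 0\<close>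
  rules this case out.\<close>

lemma prime_power_dvd_Lcm:
  fixes A :: "nat set"
  assumes "finite A" and "0 \<notin> A" and p: "prime p" and k: "k > 0" and "p ^ k dvd Lcm A"
  shows "\<exists>a\<in>A. p ^ k dvd a"
  using assms(1,2,5)
proof (induction rule: finite_induct)
  case empty
  then show ?case using p k by simp
next
  case (insert a A)
  have nz: "a \<noteq> 0" "Lcm A \<noteq> 0" using insert by (auto simp: Lcm_0_iff)
  have pu: "\<not> is_unit p" using p by auto
  have "p ^ k dvd lcm a (Lcm A)" using insert.prems by simp
  then have "k \<le> max (multiplicity p a) (multiplicity p (Lcm A))"
    using nz pu p by (simp add: power_dvd_iff_le_multiplicity multiplicity_lcm lcm_eq_0_iff)
  then have "p ^ k dvd a \<or> p ^ k dvd Lcm A"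
    using nz pu by (simp add: power_dvd_iff_le_multiplicity le_max_iff_disj)
  then show ?case using insert by auto
qed

text \<open>If \<open>j\<close> were the only such index, \<open>x j\<close> would be inverse to the
  product of the other entries, so its order would divide the least common multiple \<open>L\<close>
  of the other orders. Then \<open>p ^ k\<close> divides \<open>L\<close> and hence one of these
  orders, a contradiction.\<close>

lemma card_prime_power_dvd_orders_ne_1:
  fixes x :: "'i \<Rightarrow> 'a::comm_semiring_1"
  assumes I: "finite I" and q: "\<And>i. i \<in> I \<Longrightarrow> q i > 0"
    and ord: "\<And>i k. i \<in> I \<Longrightarrow> x i ^ k = 1 \<longleftrightarrow> q i dvd k"
    and prod1: "(\<Prod>i\<in>I. x i) = 1" and p: "prime p" "k > 0"
  shows "card {i \<in> I. p ^ k dvd q i} \<noteq> 1"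
proof
  assume "card {i \<in> I. p ^ k dvd q i} = 1"
  then obtain j where j: "{i \<in> I. p ^ k dvd q i} = {j}" by (rule card_1_singletonE)
  then have jI: "j \<in> I" "p ^ k dvd q j" by auto
  define L where "L = Lcm (q ` (I - {j}))"
  have one: "x i ^ L = 1" if "i \<in> I - {j}" for i
    using that ord by (auto simp: L_def intro!: dvd_Lcm)
  have "(\<Prod>i\<in>I-{j}. x i) ^ L = 1"
    unfolding prod_power_distrib by (intro prod.neutral ballI one)
  moreover have "x j * (\<Prod>i\<in>I-{j}. x i) = 1" using prod1 prod.remove[OF I jI(1), of x] by simp
  ultimately have "x j ^ L = 1" by (metis mult_1_right power_mult_distrib power_one)
  then have "p ^ k dvd L" using ord jI by (meson dvd_trans)
  moreover have "0 \<notin> q ` (I - {j})" using q by force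
  ultimately have "\<exists>a\<in>q ` (I - {j}). p ^ k dvd a"
    unfolding L_def using I p by (intro prime_power_dvd_Lcm) simp_all
  then show False using j by auto
qed

section \<open>Rationals as roots of unity\<close>

text \<open>The root of unity has exact order \<open>q\<close>: for \<open>b = a/q\<close> in lowest
  terms, \<open>k * e * a / q\<close> is an integer iff \<open>q\<close> divides \<open>k\<close>.
  The sign \<open>e\<close> will distinguish the two sides of the additive equation.\<close>

lemma cis_rational_power_eq_1_iff:
  assumes b: "b \<in> rationals_eq q" and q: "q > 0" and e: "e = 1 \<or> e = (-1::int)"
  shows "cis (real_of_int e * (2 * pi * b)) ^ k = 1 \<longleftrightarrow> q dvd k"
proof -
  obtain a where a: "b = real a / real q" "coprime a q" using b by (auto simp: rationals_eq_def)
  have "cis (real_of_int e * (2 * pi * b)) ^ k = 1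
    \<longleftrightarrow> (\<exists>n. real k * (real_of_int e * (2 * pi * b)) = of_int n * (2 * pi))"
    unfolding Complex.DeMoivre by (rule cis_eq_1_iff)
  also have "\<dots> \<longleftrightarrow> (\<exists>n. int k * e * int a = n * int q)"
  proof (rule ex_cong1)
    fix n
    have "real k * (real_of_int e * (2 * pi * b)) = of_int n * (2 * pi)
      \<longleftrightarrow> real k * real_of_int e * real a = of_int n * real q"
      using q by (simp add: a field_simps)
    also have "\<dots> \<longleftrightarrow> real_of_int (int k * e * int a) = real_of_int (n * int q)" by simp
    also have "\<dots> \<longleftrightarrow> int k * e * int a = n * int q" by (rule of_int_eq_iff)
    finally show "real k * (real_of_int e * (2 * pi * b)) = of_int n * (2 * pi)
      \<longleftrightarrow> int k * e * int a = n * int q" .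
  qed
  also have "\<dots> \<longleftrightarrow> int q dvd int k * e * int a" by (auto simp: dvd_def mult.commute)
  also have "\<dots> \<longleftrightarrow> int q dvd int (k * a)" using e by auto
  also have "\<dots> \<longleftrightarrow> q dvd k"
    using a(2) by (simp only: int_dvd_int_iff) (simp add: coprime_dvd_mult_left_iff coprime_commute)
  finally show ?thesis .
qed

text \<open>Equal values force an integer difference, and the rationals lie in the half-open
  interval from 0 (excluded, as \<open>a \<ge> 1\<close>) to 1, where differences are less than 1 in
  absolute value.\<close>

lemma inj_on_cis_rationals:
  assumes e: "e = 1 \<or> e = (-1::int)"
  shows "inj_on (\<lambda>b. cis (real_of_int e * (2 * pi * b))) (rationals_eq q)"
proof (rule inj_onI)
  fix b c assume b: "b \<in> rationals_eq q" and c: "c \<in> rationals_eq q"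
    and eq: "cis (real_of_int e * (2 * pi * b)) = cis (real_of_int e * (2 * pi * c))"
  have range: "0 < b" "b \<le> 1" "0 < c" "c \<le> 1" using b c by (auto simp: rationals_eq_def)
  have "cis (real_of_int e * (2 * pi * b) - real_of_int e * (2 * pi * c)) = 1"
    using eq by (simp add: cis_divide[symmetric] del: cis_divide)
  then obtain n where "real_of_int e * (2 * pi * b) - real_of_int e * (2 * pi * c) = of_int n * (2 * pi)"
    by (auto simp: cis_eq_1_iff)
  then have "(real_of_int e * (b - c)) * (2 * pi) = of_int n * (2 * pi)" by (simp add: algebra_simps)
  then have n: "real_of_int e * (b - c) = of_int n" by simp
  then have "\<bar>real_of_int n\<bar> = \<bar>b - c\<bar>" using e by auto
  also have "\<dots> < 1" using range by (auto simp: abs_if)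
  finally have "n = 0" by linarith
  then show "b = c" using n e by auto
qed

section \<open>Solutions with prescribed denominators\<close>

lemma prod_cis: "(\<Prod>i\<in>A. cis (t i)) = cis (\<Sum>i\<in>A. t i)"
  by (induction A rule: infinite_finite_induct) (auto simp: cis_mult)

lemma sqrt_prod: "sqrt (\<Prod>i\<in>A. f i) = (\<Prod>i\<in>A. sqrt (f i))"
  by (induction A rule: infinite_finite_induct) (auto simp: real_sqrt_mult)

lemma finite_rationals_eq: "finite (rationals_eq q)"
proof (rule finite_subset)
  show "rationals_eq q \<subseteq> (\<lambda>a. real a / real q) ` {1..q}" by (auto simp: rationals_eq_def)
qed simp

text \<open>Exponentials embed \<open>N\<close> into the tuples with product 1, which are already
  counted. It remains to rewrite the weights: the power \<open>card S - 2\<close> of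
  \<open>sqrt (d S)\<close> is its power \<open>card S\<close> divided by \<open>d S\<close>, and
  the powers \<open>card S\<close> multiply to the product of the \<open>sqrt (q i)\<close>.\<close>

lemma card_solutions_fixed_denominators_le:
  fixes q :: "nat \<Rightarrow> nat" and D :: "nat \<Rightarrow> real set" and Q n :: real and m :: nat
  defines "I \<equiv> {1..2*m}"
  defines "N \<equiv> {b \<in> Pi\<^sub>E I D. (\<Sum>i=1..m. b i) = (\<Sum>i=m+1..2*m. b i)}"
  assumes q: "\<And>i. i \<in> I \<Longrightarrow> q i > 0" "\<And>i. i \<in> I \<Longrightarrow> real (q i) \<le> Q" and Q: "Q \<ge> 0"
    and D: "\<And>i. i \<in> I \<Longrightarrow> D i \<subseteq> rationals_eq (q i)" "\<And>i. i \<in> I \<Longrightarrow> real (card (D i)) \<le> n"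
    and n: "n \<ge> 0" and ne: "N \<noteq> {}"
  shows "\<exists>d. (\<forall>S. d S > 0) \<and> (\<forall>i\<in>I. q i = (\<Prod>S\<in>{S \<in> nontrivial_subsets I. i \<in> S}. d S)) \<and>
    real (card N) \<le> (Q * n) ^ m * (\<Prod>S\<in>nontrivial_subsets I. 1 / real (d S))"
proof -
  let ?P = "nontrivial_subsets I"
  \<comment> \<open>The minus sign on the second half of the indices turns the equation between the
    two sums into a product equal to 1.\<close>
  define e where "e i = (if i \<le> m then 1 else -1 :: int)" for i
  define \<psi> where "\<psi> = (\<lambda>i b. cis (real_of_int (e i) * (2 * pi * b)))"
  define X where "X i = \<psi> i ` D i" for i
  have I: "finite I" by (simp add: I_def)
  have finP: "finite ?P" using I by (rule finite_nontrivial_subsets)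
  have e: "e i = 1 \<or> e i = -1" for i by (simp add: e_def)
  have finD: "finite (D i)" if "i \<in> I" for i
    using D(1)[OF that] finite_rationals_eq by (rule finite_subset)
  have inj: "inj_on (\<psi> i) (D i)" if "i \<in> I" for i
    using inj_on_subset[OF inj_on_cis_rationals[OF e[of i]] D(1)[OF that]] by (simp add: \<psi>_def)
  have ord: "\<psi> i b ^ k = 1 \<longleftrightarrow> q i dvd k" if "i \<in> I" "b \<in> D i" for i b k
    unfolding \<psi>_def using D(1) q(1) that by (intro cis_rational_power_eq_1_iff e) auto
  have prod1: "(\<Prod>i\<in>I. \<psi> i (b i)) = 1" if "b \<in> N" for b
  proof -
    have I_split: "I = {1..m} \<union> {m+1..2*m}" by (auto simp: I_def)
    have "(\<Sum>i\<in>I. real_of_int (e i) * (2 * pi * b i))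
      = (\<Sum>i=1..m. real_of_int (e i) * (2 * pi * b i)) + (\<Sum>i=m+1..2*m. real_of_int (e i) * (2 * pi * b i))"
      unfolding I_split by (rule sum.union_disjoint) auto
    also have "(\<Sum>i=1..m. real_of_int (e i) * (2 * pi * b i)) = 2 * pi * (\<Sum>i=1..m. b i)"
      by (simp add: e_def sum_distrib_left)
    also have "(\<Sum>i=m+1..2*m. real_of_int (e i) * (2 * pi * b i)) = - (2 * pi * (\<Sum>i=m+1..2*m. b i))"
      by (simp add: e_def sum_distrib_left sum_negf)
    finally show ?thesis using that by (simp add: \<psi>_def prod_cis N_def)
  qed
  define \<Psi> where "\<Psi> b = (\<lambda>i\<in>I. \<psi> i (b i))" for b
  have "inj_on \<Psi> N"
  proof (rule inj_onI)
    fix b c assume bc: "b \<in> N" "c \<in> N" "\<Psi> b = \<Psi> c"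
    show "b = c"
    proof (rule PiE_ext[of b I D c])
      fix i assume i: "i \<in> I"
      then have "\<psi> i (b i) = \<psi> i (c i)" using fun_cong[OF bc(3), of i] by (simp add: \<Psi>_def)
      then show "b i = c i" using inj[OF i] bc i by (auto simp: N_def PiE_iff dest: inj_onD)
    qed (use bc in \<open>auto simp: N_def\<close>)
  qed
  moreover have "\<Psi> ` N \<subseteq> prod_one_tuples I X"
    using prod1 by (auto simp: prod_one_tuples_def \<Psi>_def X_def PiE_iff N_def)
  moreover have "finite (prod_one_tuples I X)"
    using finD by (intro finite_prod_one_tuples I) (auto simp: X_def)
  ultimately have card_le: "card N \<le> card (prod_one_tuples I X)" by (rule card_inj_on_le)
  \<comment> \<open>A single solution suffices: its exponentials have exact orders
    \<open>q i\<close> and product 1, which gives the hypothesis on prime powers.\<close>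
  obtain b where b: "b \<in> N" using ne by auto
  have "\<exists>d. (\<forall>S. d S > 0) \<and> (\<forall>i\<in>I. q i = (\<Prod>S\<in>{S \<in> ?P. i \<in> S}. d S)) \<and>
    real (card (prod_one_tuples I X))
      \<le> (\<Prod>S\<in>?P. sqrt (real (d S)) ^ (card S - 2)) * (\<Prod>i\<in>I. sqrt (real (card (X i))))"
  proof (rule card_prod_one_roots_of_unity_le)
    fix p k :: nat assume "prime p" "k > 0"
    then show "card {i \<in> I. p ^ k dvd q i} \<noteq> 1"
      using card_prime_power_dvd_orders_ne_1[OF I q(1) _ prod1[OF b]] ord b
      by (auto simp: N_def PiE_iff)
  qed (use I q ord in \<open>auto simp: X_def\<close>)
  then obtain d where d: "\<And>S. d S > 0" "\<And>i. i \<in> I \<Longrightarrow> q i = (\<Prod>S\<in>{S \<in> ?P. i \<in> S}. d S)"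
    "real (card (prod_one_tuples I X))
      \<le> (\<Prod>S\<in>?P. sqrt (real (d S)) ^ (card S - 2)) * (\<Prod>i\<in>I. sqrt (real (card (X i))))"
    by blast
  have "(\<Prod>S\<in>?P. sqrt (real (d S)) ^ (card S - 2))
    = (\<Prod>S\<in>?P. \<Prod>i\<in>{i \<in> I. i \<in> S}. sqrt (real (d S))) * (\<Prod>S\<in>?P. 1 / real (d S))"
    unfolding prod.distrib[symmetric]
  proof (rule prod.cong[OF refl])
    fix S assume S: "S \<in> ?P"
    then have "{i \<in> I. i \<in> S} = S" and "card S = (card S - 2) + 2"
      by (auto simp: nontrivial_subsets_def)
    then have "(\<Prod>i\<in>{i \<in> I. i \<in> S}. sqrt (real (d S))) = sqrt (real (d S)) ^ ((card S - 2) + 2)"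
      by simp
    also have "\<dots> = sqrt (real (d S)) ^ (card S - 2) * real (d S)" by (subst power_add) simp
    finally show "sqrt (real (d S)) ^ (card S - 2)
      = (\<Prod>i\<in>{i \<in> I. i \<in> S}. sqrt (real (d S))) * (1 / real (d S))"
      using d(1)[of S] by simp
  qed
  \<comment> \<open>Exchanging the products collects, for each \<open>i\<close>, all factors
    \<open>d S\<close> with \<open>i \<in> S\<close>, that is \<open>q i\<close>.\<close>
  also have "(\<Prod>S\<in>?P. \<Prod>i\<in>{i \<in> I. i \<in> S}. sqrt (real (d S)))
    = (\<Prod>i\<in>I. \<Prod>S\<in>{S \<in> ?P. i \<in> S}. sqrt (real (d S)))"
    by (rule prod.swap_restrict[OF finP I])
  also have "\<dots> = (\<Prod>i\<in>I. sqrt (real (q i)))"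
    by (intro prod.cong refl) (simp add: d(2) sqrt_prod)
  finally have weights: "(\<Prod>S\<in>?P. sqrt (real (d S)) ^ (card S - 2))
    = (\<Prod>i\<in>I. sqrt (real (q i))) * (\<Prod>S\<in>?P. 1 / real (d S))" .
  \<comment> \<open>Each of the \<open>2*m\<close> indices contributes at most
    \<open>sqrt (Q * n)\<close>.\<close>
  have "(\<Prod>i\<in>I. sqrt (real (q i))) * (\<Prod>i\<in>I. sqrt (real (card (X i))))
    = (\<Prod>i\<in>I. sqrt (real (q i)) * sqrt (real (card (X i))))" by (simp add: prod.distrib)
  also have "\<dots> \<le> (\<Prod>i\<in>I. sqrt Q * sqrt n)"
  proof (intro prod_mono conjI mult_mono)
    fix i assume "i \<in> I"
    then have "card (X i) = card (D i)" using card_image[OF inj] by (simp add: X_def)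
    then show "sqrt (real (card (X i))) \<le> sqrt n" using D(2)[OF \<open>i \<in> I\<close>] by simp
  qed (use q Q n in auto)
  also have "\<dots> = (Q * n) ^ m"
    using Q n by (simp add: I_def power_mult real_sqrt_mult[symmetric])
  finally have size: "(\<Prod>i\<in>I. sqrt (real (q i))) * (\<Prod>i\<in>I. sqrt (real (card (X i)))) \<le> (Q * n) ^ m" .
  have "real (card N) \<le> (\<Prod>i\<in>I. sqrt (real (q i))) * (\<Prod>S\<in>?P. 1 / real (d S)) *
      (\<Prod>i\<in>I. sqrt (real (card (X i))))"
    using card_le d(3) unfolding weights by linarith
  also have "\<dots> = (\<Prod>i\<in>I. sqrt (real (q i))) * (\<Prod>i\<in>I. sqrt (real (card (X i)))) *
      (\<Prod>S\<in>?P. 1 / real (d S))" by simp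
  also have "\<dots> \<le> (Q * n) ^ m * (\<Prod>S\<in>?P. 1 / real (d S))"
    using size by (intro mult_right_mono prod_nonneg) auto
  finally show ?thesis using d(1,2) by blast
qed

section \<open>Summation over the denominators\<close>

text \<open>The solutions are sorted by their denominators \<open>q\<close>. Since \<open>q\<close>
  can be recovered from its factors \<open>d S\<close>, the sum over \<open>q\<close> is bounded by
  a sum over all families of integers in \<open>{1..M}\<close> indexed by \<open>?P\<close>, which
  splits into one harmonic sum for each \<open>S\<close>.\<close>

lemma additive_energy_le_harm_power:
  fixes Q n :: real
  assumes Q: "Q \<ge> 1" and n: "n \<ge> 0" and B: "B \<subseteq> rationals_le Q"
    and Bn: "\<And>q::nat. 1 \<le> q \<Longrightarrow> real q \<le> Q \<Longrightarrow> real (card (B \<inter> rationals_eq q)) \<le> n"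
  shows "real (additive_energy m B) \<le> harm (nat \<lfloor>Q\<rfloor>) ^ (4 ^ m) * (Q * n) ^ m"
proof -
  define I where "I = {1..2*m}"
  define M where "M = nat \<lfloor>Q\<rfloor>"
  let ?P = "nontrivial_subsets I"
  define N where "N q = {b \<in> Pi\<^sub>E I (\<lambda>i. B \<inter> rationals_eq (q i)).
    (\<Sum>i=1..m. b i) = (\<Sum>i=m+1..2*m. b i)}" for q :: "nat \<Rightarrow> nat"
  \<comment> \<open>Only denominators that admit a solution are kept, because the bound for fixed
    denominators needs one.\<close>
  define W where "W = {q \<in> Pi\<^sub>E I (\<lambda>_. {1..M}). N q \<noteq> {}}"
  have I: "finite I" by (simp add: I_def)
  have finP: "finite ?P" using I by (rule finite_nontrivial_subsets)
  have M: "k \<le> M \<longleftrightarrow> real k \<le> Q" for k unfolding M_def using Q by (simp add: le_nat_iff le_floor_iff)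
  have finW: "finite W" unfolding W_def using I by (simp add: finite_PiE)
  have finN: "finite (N q)" for q
    unfolding N_def using I finite_rationals_eq
    by (intro finite_subset[OF _ finite_PiE[of I "\<lambda>i. B \<inter> rationals_eq (q i)"]]) auto
  have "{b \<in> I \<rightarrow>\<^sub>E B. (\<Sum>i=1..m. b i) = (\<Sum>i=m+1..2*m. b i)} \<subseteq> (\<Union>q\<in>W. N q)"
  proof
    fix b assume b: "b \<in> {b \<in> I \<rightarrow>\<^sub>E B. (\<Sum>i=1..m. b i) = (\<Sum>i=m+1..2*m. b i)}"
    have "\<forall>i\<in>I. \<exists>q. 1 \<le> q \<and> real q \<le> Q \<and> b i \<in> rationals_eq q"
    proof
      fix i assume "i \<in> I"
      then have "b i \<in> rationals_le Q" using b B by (auto simp: PiE_iff)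
      then show "\<exists>q. 1 \<le> q \<and> real q \<le> Q \<and> b i \<in> rationals_eq q"
        by (auto simp: rationals_le_def)
    qed
    then obtain q where q: "\<forall>i\<in>I. 1 \<le> q i \<and> real (q i) \<le> Q \<and> b i \<in> rationals_eq (q i)"
      by (rule bchoice[THEN exE])
    have "b \<in> N (restrict q I)" using b q by (auto simp: N_def PiE_iff)
    moreover have "restrict q I \<in> Pi\<^sub>E I (\<lambda>_. {1..M})" using q M by (auto simp: PiE_iff)
    ultimately show "b \<in> (\<Union>q\<in>W. N q)" unfolding W_def by blast
  qed
  then have "additive_energy m B \<le> card (\<Union>q\<in>W. N q)"
    unfolding additive_energy_def I_def[symmetric] using finW finN by (intro card_mono) auto
  also have "\<dots> \<le> (\<Sum>q\<in>W. card (N q))" by (rule card_UN_le[OF finW])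
  finally have energy: "real (additive_energy m B) \<le> (\<Sum>q\<in>W. real (card (N q)))"
    by (metis of_nat_le_iff of_nat_sum)
  have "\<forall>q\<in>W. \<exists>d. (\<forall>S. d S > 0) \<and> (\<forall>i\<in>I. q i = (\<Prod>S\<in>{S \<in> ?P. i \<in> S}. d S)) \<and>
    real (card (N q)) \<le> (Q * n) ^ m * (\<Prod>S\<in>?P. 1 / real (d S))"
  proof
    fix q assume q: "q \<in> W"
    then have qi: "1 \<le> q i" "real (q i) \<le> Q" if "i \<in> I" for i
      using that M by (auto simp: W_def PiE_iff)
    show "\<exists>d. (\<forall>S. d S > 0) \<and> (\<forall>i\<in>I. q i = (\<Prod>S\<in>{S \<in> ?P. i \<in> S}. d S)) \<and>
      real (card (N q)) \<le> (Q * n) ^ m * (\<Prod>S\<in>?P. 1 / real (d S))"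
      unfolding N_def I_def
      by (rule card_solutions_fixed_denominators_le)
        (use q qi Q n Bn in \<open>auto simp: W_def N_def I_def Suc_le_eq\<close>)
  qed
  then obtain \<delta> where "\<forall>q\<in>W. (\<forall>S. \<delta> q S > 0) \<and>
    (\<forall>i\<in>I. q i = (\<Prod>S\<in>{S \<in> ?P. i \<in> S}. \<delta> q S)) \<and>
    real (card (N q)) \<le> (Q * n) ^ m * (\<Prod>S\<in>?P. 1 / real (\<delta> q S))"
    by (rule bchoice[THEN exE])
  then have \<delta>: "\<And>q S. q \<in> W \<Longrightarrow> \<delta> q S > 0"
    "\<And>q i. q \<in> W \<Longrightarrow> i \<in> I \<Longrightarrow> q i = (\<Prod>S\<in>{S \<in> ?P. i \<in> S}. \<delta> q S)"
    "\<And>q. q \<in> W \<Longrightarrow> real (card (N q)) \<le> (Q * n) ^ m * (\<Prod>S\<in>?P. 1 / real (\<delta> q S))"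
    by blast+
  let ?r = "\<lambda>q. restrict (\<delta> q) ?P"
  have inj: "inj_on ?r W"
  proof (rule inj_onI)
    fix q q' assume q: "q \<in> W" "q' \<in> W" "?r q = ?r q'"
    have "\<delta> q S = \<delta> q' S" if "S \<in> ?P" for S using fun_cong[OF q(3), of S] that by simp
    then have "(\<Prod>S\<in>{S \<in> ?P. i \<in> S}. \<delta> q S) = (\<Prod>S\<in>{S \<in> ?P. i \<in> S}. \<delta> q' S)" for i
      by (intro prod.cong) auto
    then have "q i = q' i" if "i \<in> I" for i
      using \<delta>(2)[OF q(1) that] \<delta>(2)[OF q(2) that] by simp
    then show "q = q'" using q by (intro PiE_ext[of q I _ q']) (auto simp: W_def)
  qed
  \<comment> \<open>Every \<open>S\<close> contains some \<open>i\<close>, and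
    \<open>\<delta> q S\<close> divides \<open>q i\<close>, which is at most
    \<open>M\<close>.\<close>
  have range: "?r ` W \<subseteq> Pi\<^sub>E ?P (\<lambda>_. {1..M})"
  proof (clarsimp simp: PiE_iff)
    fix q S assume q: "q \<in> W" and S: "S \<in> ?P"
    then obtain i where i: "i \<in> S" "i \<in> I"
      by (metis (no_types, lifting) Pow_iff card.empty ex_in_conv mem_Collect_eq
          nontrivial_subsets_def not_numeral_le_zero subsetD)
    have "\<delta> q S dvd q i" unfolding \<delta>(2)[OF q i(2)] using finP S i by (intro dvd_prodI) auto
    moreover have "1 \<le> q i" "q i \<le> M" using q i by (auto simp: W_def PiE_iff)
    ultimately show "Suc 0 \<le> \<delta> q S \<and> \<delta> q S \<le> M"
      using \<delta>(1)[OF q, of S] dvd_imp_le[of "\<delta> q S" "q i"] by auto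
  qed
  have "(\<Sum>q\<in>W. \<Prod>S\<in>?P. 1 / real (\<delta> q S)) = (\<Sum>d\<in>?r ` W. \<Prod>S\<in>?P. 1 / real (d S))"
    by (subst sum.reindex[OF inj]) auto
  also have "\<dots> \<le> (\<Sum>d\<in>Pi\<^sub>E ?P (\<lambda>_. {1..M}). \<Prod>S\<in>?P. 1 / real (d S))"
    using range finP by (intro sum_mono2 finite_PiE prod_nonneg) auto
  also have "\<dots> = (\<Prod>S\<in>?P. \<Sum>k\<in>{1..M}. 1 / real k)"
    using finP by (intro prod_sum_PiE[symmetric]) auto
  also have "\<dots> = harm M ^ card ?P" by (simp add: harm_def divide_inverse)
  \<comment> \<open>A set of \<open>2*m\<close> indices has \<open>4 ^ m\<close> subsets; enlarging
    the exponent is allowed as \<open>harm M \<ge> 1\<close>.\<close>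
  also have "\<dots> \<le> harm M ^ (4 ^ m)"
  proof (rule power_increasing)
    have "card ?P \<le> card (Pow I)" using I by (intro card_mono) (auto simp: nontrivial_subsets_def)
    also have "\<dots> = 4 ^ m" by (simp add: card_Pow I I_def power_mult)
    finally show "card ?P \<le> 4 ^ m" .
    have "1 \<le> M" using M[of 1] Q by simp
    then show "(1::real) \<le> harm M" using harm_mono[of 1 M, where 'a=real] by (simp add: harm_expand)
  qed
  finally have weights: "(\<Sum>q\<in>W. \<Prod>S\<in>?P. 1 / real (\<delta> q S)) \<le> harm M ^ (4 ^ m)" .
  have "(\<Sum>q\<in>W. real (card (N q))) \<le> (\<Sum>q\<in>W. (Q * n) ^ m * (\<Prod>S\<in>?P. 1 / real (\<delta> q S)))"
    by (intro sum_mono \<delta>(3))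
  also have "\<dots> \<le> (Q * n) ^ m * harm M ^ (4 ^ m)"
    unfolding sum_distrib_left[symmetric] using weights Q n by (intro mult_left_mono) auto
  finally show ?thesis using energy by (simp add: M_def mult.commute)
qed

section \<open>From harmonic sums to powers of the logarithm\<close>

text \<open>The difference of \<open>harm\<close> and \<open>ln\<close> decreases from its value 1
  at 1, so the harmonic sum is at most \<open>1 + ln Q\<close>. The cube absorbs the summand 1,
  leaving a pure power of \<open>ln Q\<close>.\<close>

lemma harm_floor_le_ln_cube:
  fixes Q :: real
  assumes Q: "Q \<ge> 4"
  shows "harm (nat \<lfloor>Q\<rfloor>) \<le> (ln Q) ^ 3"
proof -
  let ?M = "nat \<lfloor>Q\<rfloor>"
  have M: "1 \<le> ?M" "real ?M \<le> Q" using Q by (auto simp: le_nat_floor)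
  have "harm ?M - ln (real ?M) \<le> harm 1 - ln (real 1)"
    using M by (intro euler_mascheroni_sequence_decreasing) auto
  then have "harm ?M \<le> 1 + ln (real ?M)" by (simp add: harm_expand)
  also have "\<dots> \<le> 1 + ln Q" using M by simp
  also have "1 + ln Q \<le> (ln Q) ^ 3"
  proof -
    have "ln 4 = 2 * ln (2::real)" using ln_realpow[of 2 2] by simp
    then have L: "4 / 3 \<le> ln Q" using ln2_ge_two_thirds Q ln_le_cancel_iff[of 4 Q] by linarith
    \<comment> \<open>The surplus \<open>7/9 * ln Q\<close> is at least \<open>28/27\<close>, which
      covers the summand 1.\<close>
    have "16 / 9 * ln Q \<le> (ln Q)\<^sup>2 * ln Q"
      using L power_mono[OF L, of 2] by (intro mult_right_mono) (auto simp: power2_eq_square)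
    also have "\<dots> = (ln Q) ^ 3" by (simp add: power3_eq_cube power2_eq_square)
    finally show ?thesis using L by linarith
  qed
  finally show ?thesis .
qed

theorem theorem2:
  "\<exists>C::real. C > 0 \<and>
     (\<forall>(Q::real) (m::nat) (n::real) (B::real set).
        Q \<ge> 4 \<longrightarrow> m \<ge> 2 \<longrightarrow> n \<ge> 1 \<longrightarrow>
        B \<subseteq> rationals_le Q \<longrightarrow>
        (\<forall>q::nat. 1 \<le> q \<and> real q \<le> Q \<longrightarrow> real (card (B \<inter> rationals_eq q)) \<le> n) \<longrightarrow>
        real (additive_energy m B) \<le> (ln Q) powr (C ^ m) * (Q * n) ^ m)"
\<comment> \<open>The constant is \<open>3 * 4\<close>: the exponent \<open>4 ^ m\<close> counts
  subsets, the 3 comes from the cube, and \<open>3 * 4 ^ m \<le> 12 ^ m\<close>.\<close>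
proof (intro exI[of _ 12] conjI allI impI)
  fix Q n :: real and m :: nat and B :: "real set"
  assume Q: "Q \<ge> 4" and m: "m \<ge> 2" and n: "n \<ge> 1" and B: "B \<subseteq> rationals_le Q"
    and Bn: "\<forall>q::nat. 1 \<le> q \<and> real q \<le> Q \<longrightarrow> real (card (B \<inter> rationals_eq q)) \<le> n"
  \<comment> \<open>This holds as \<open>exp 1 \<le> 3 < 4\<close>; it makes powers of
    \<open>ln Q\<close> increase with the exponent.\<close>
  have L: "1 < ln Q" using ln_ge_iff[of 4 1] exp_le Q by (smt (verit) exp_less_cancel_iff exp_ln)
  have "harm (nat \<lfloor>Q\<rfloor>) ^ (4 ^ m) \<le> ((ln Q) ^ 3) ^ (4 ^ m)"
    using harm_floor_le_ln_cube[OF Q] by (intro power_mono harm_nonneg)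
  also have "\<dots> = (ln Q) ^ (3 * 4 ^ m)" by (simp add: power_mult)
  also have "\<dots> \<le> (ln Q) ^ (12 ^ m)"
  proof (rule power_increasing)
    have "(3::nat) ^ 1 \<le> 3 ^ m" using m by (intro power_increasing) auto
    then have "3 * 4 ^ m \<le> 3 ^ m * (4::nat) ^ m" by (intro mult_right_mono) auto
    then show "3 * 4 ^ m \<le> (12::nat) ^ m" by (simp add: power_mult_distrib[symmetric])
  qed (use L in simp)
  also have "\<dots> = (ln Q) powr (12 ^ m)" using L by (subst powr_realpow[symmetric]) auto
  finally have "harm (nat \<lfloor>Q\<rfloor>) ^ (4 ^ m) * (Q * n) ^ m \<le> (ln Q) powr (12 ^ m) * (Q * n) ^ m"
    using Q n by (intro mult_right_mono) auto
  moreover have "real (additive_energy m B) \<le> harm (nat \<lfloor>Q\<rfloor>) ^ (4 ^ m) * (Q * n) ^ m"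
    by (rule additive_energy_le_harm_power) (use Q n B Bn in auto)
  ultimately show "real (additive_energy m B) \<le> (ln Q) powr (12 ^ m) * (Q * n) ^ m" by linarith
qed simp

end
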